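(* Let $M=\prod_{n\ge 2}^{\ell^\infty} M_n(\mathbb{C})$ be the von Neumann algebra of bounded sequences of matrices and $M^+$ its cone of positive elements. The set of weakly paveable elements of $M^+$ is open in $M^+$ for the (relative) norm topology, and it is closed under multiplication by strictly positive scalars.
   Context: For $n\ge 2$ let $M_n$ be the $n\times n$ complex matrices with the operator norm and $D_n\subset M_n$ the diagonal matrices. $M$ is the $\ell^\infty$-direct sum of the $M_n$, $n\ge 2$: its elements are sequences $a=\{a_n\}_{n\ge 2}$ with $a_n\in M_n$ and $\|a\|=\sup_n\|a_n\|<\infty$, with coordinatewise operations. $D\subset M$ is the subalgebra of those $a$ with $a_n\in D_n$ for all $n$. $\mathcal{P}:M\to D$ is the conditional expectation which replaces each $a_n$ by its diagonal part. Let $x_n\in M$ be the unit of $M_n$ viewed as a summand of $M$. An element $a\in M$ is compact if $\lim_{n\to\infty}\|x_na\|=0$; $K$ is the closed ideal of compact elements, and $\pi:M\to M/K$ is the quotient map (with the quotient $C^*$-norm on $M/K$). A non-compact element $x\in M^+$ is weakly paveable if there exist a natural number $m$ and projections $p_1,\dots,p_m\in D$ such that $\sum_j p_j=1$ and $\|\pi(p_j(x-\mathcal{P}(x))p_j)\|<\|\pi(x)\|$ for all $j=1,\dots,m$. *)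

theory Defs
  imports
    "HOL-Analysis.Abstract_Metric_Spaces"
    "HOL-Analysis.L2_Norm"
    "HOL-Algebra.QuotRing"
    "HOL-Algebra.Module"
    "Jordan_Normal_Form.Schur_Decomposition"
begin

definition euclid_norm :: "complex vec \<Rightarrow> real" where
  "euclid_norm v = L2_set (\<lambda>i. cmod (vec_index v i)) {..<dim_vec v}"

definition op_norm :: "complex mat \<Rightarrow> real" where
  "op_norm A = (SUP v \<in> {v \<in> carrier_vec (dim_col A). euclid_norm v \<le> 1}. euclid_norm (A *\<^sub>v v))"

text \<open>Sequences of matrices are functions on \<open>nat\<close> that are \<^const>\<open>undefined\<close> outside \<open>{2..}\<close>
  (extensional functions), so that equality in the carrier is coordinatewise equality.
  The algebra structure is a \<open>module\<close> record of HOL-Algebra, whose \<^const>\<open>module.smult\<close>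
  is multiplication by complex scalars.\<close>

type_synonym mat_seq = "nat \<Rightarrow> complex mat"

definition linf_alg :: "(complex, mat_seq) module" where
  "linf_alg = \<lparr>
     carrier = {a \<in> (\<Pi>\<^sub>E n\<in>{2..}. carrier_mat n n). bdd_above ((\<lambda>n. op_norm (a n)) ` {2..})},
     monoid.mult = (\<lambda>a b. \<lambda>n\<in>{2..}. a n * b n),
     one = (\<lambda>n\<in>{2..}. 1\<^sub>m n),
     zero = (\<lambda>n\<in>{2..}. 0\<^sub>m n n),
     add = (\<lambda>a b. \<lambda>n\<in>{2..}. a n + b n),
     module.smult = (\<lambda>c a. \<lambda>n\<in>{2..}. c \<cdot>\<^sub>m a n) \<rparr>"

definition linf_norm :: "mat_seq \<Rightarrow> real" where
  "linf_norm a = (SUP n\<in>{2..}. op_norm (a n))"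

definition linf_star :: "mat_seq \<Rightarrow> mat_seq" where
  "linf_star a = (\<lambda>n\<in>{2..}. mat_adjoint (a n))"

definition linf_pos :: "mat_seq set" where
  "linf_pos = {linf_star b \<otimes>\<^bsub>linf_alg\<^esub> b | b. b \<in> carrier linf_alg}"

text \<open>The value \<open>0\<close> off the carrier is there because the locale \<^locale>\<open>Metric_space\<close> requires
  nonnegativity and symmetry of the distance on the whole type.\<close>

definition linf_dist :: "mat_seq \<Rightarrow> mat_seq \<Rightarrow> real" where
  "linf_dist a b =
     (if a \<in> carrier linf_alg \<and> b \<in> carrier linf_alg then linf_norm (a \<ominus>\<^bsub>linf_alg\<^esub> b) else 0)"

definition linf_pos_topology :: "mat_seq topology" where
  "linf_pos_topology =
     subtopology (Metric_space.mtopology (carrier linf_alg) linf_dist) linf_pos"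

definition diag_subalg :: "mat_seq set" where
  "diag_subalg = {a \<in> carrier linf_alg. \<forall>n\<ge>2. diagonal_mat (a n)}"

definition diag_expectation :: "mat_seq \<Rightarrow> mat_seq" where
  "diag_expectation a = (\<lambda>n\<in>{2..}. mat_diag n (\<lambda>i. a n $$ (i, i)))"

definition block_unit :: "nat \<Rightarrow> mat_seq" where
  "block_unit n = (\<lambda>k\<in>{2..}. if k = n then 1\<^sub>m k else 0\<^sub>m k k)"

definition compact_ideal :: "mat_seq set" where
  "compact_ideal =
     {a \<in> carrier linf_alg. (\<lambda>n. linf_norm (block_unit n \<otimes>\<^bsub>linf_alg\<^esub> a)) \<longlonglongrightarrow> 0}"

text \<open>Elements of the quotient algebra \<open>linf_alg Quot compact_ideal\<close> are additive cosets;
  the quotient norm of a coset is the infimum of the norms of its members.\<close>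

definition quot_map :: "mat_seq \<Rightarrow> mat_seq set" where
  "quot_map a = compact_ideal +>\<^bsub>linf_alg\<^esub> a"

definition quot_norm :: "mat_seq set \<Rightarrow> real" where
  "quot_norm X = (INF a\<in>X. linf_norm a)"

definition linf_projection :: "mat_seq \<Rightarrow> bool" where
  "linf_projection p \<longleftrightarrow>
     p \<in> carrier linf_alg \<and> p \<otimes>\<^bsub>linf_alg\<^esub> p = p \<and> linf_star p = p"

definition weakly_paveable :: "mat_seq \<Rightarrow> bool" where
  "weakly_paveable x \<longleftrightarrow>
     x \<in> linf_pos \<and> x \<notin> compact_ideal \<and>
     (\<exists>(m::nat) p.
        (\<forall>j\<in>{1..m}. p j \<in> diag_subalg \<and> linf_projection (p j)) \<and>
        finsum linf_alg p {1..m} = \<one>\<^bsub>linf_alg\<^esub> \<and>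
        (\<forall>j\<in>{1..m}.
           quot_norm (quot_map
             (p j \<otimes>\<^bsub>linf_alg\<^esub> (x \<ominus>\<^bsub>linf_alg\<^esub> diag_expectation x) \<otimes>\<^bsub>linf_alg\<^esub> p j))
           < quot_norm (quot_map x)))"

end

theory Submission
  imports Defs
begin

text \<open>For fixed \<open>p\<^sub>j\<close>, both sides of the paving inequality
  \<open>\<parallel>\<pi>(p\<^sub>j (x - \<P> x) p\<^sub>j)\<parallel> < \<parallel>\<pi>(x)\<parallel>\<close> are Lipschitz functions of \<open>x\<close>, because the quotient norm
  and \<open>\<P>\<close> are contractive; so a partition that paves \<open>x\<close> also paves every \<open>y\<close> close to \<open>x\<close>.
  Both sides are positively homogeneous, whence the invariance under scaling.\<close>

text \<open>Positivity is not an open condition in \<open>M\<close>, whereas the paving inequalities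
  make sense for every element of \<open>M\<close>. Openness is therefore proved in the full metric
  space for the set cut out by the inequalities alone, and positivity re-enters by intersecting with
  \<open>linf_pos\<close>, which is what relative openness means. The Lipschitz constant of the left
  side is \<open>2 * (linf_norm p)^2\<close>: one factor \<open>linf_norm p\<close> for each
  multiplication by \<open>p\<close>, and 2 from the triangle inequality for \<open>x\<close> minus
  its diagonal part. A crude constant is enough, because the projections stay fixed while
  \<open>x\<close> moves and there are only finitely many of them. Both the operator norm and the
  quotient norm are extrema of sets of reals, which carry information only for nonempty sets bounded
  on the right side; much of the groundwork supplies these two facts.\<close>

unbundle no vec_syntax

section \<open>The operator norm\<close>

lemma euclid_norm_nonneg [simp]: "euclid_norm v \<ge> 0"
  by (simp add: euclid_norm_def L2_set_nonneg)

lemma euclid_norm_zero [simp]: "euclid_norm (0\<^sub>v n) = 0"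
  by (simp add: euclid_norm_def L2_set_def)

lemma euclid_norm_eq_0_iff: "euclid_norm v = 0 \<longleftrightarrow> v = 0\<^sub>v (dim_vec v)"
proof
  assume "euclid_norm v = 0"
  then have "\<forall>i<dim_vec v. v $ i = 0"
    by (simp add: euclid_norm_def L2_set_eq_0_iff)
  then show "v = 0\<^sub>v (dim_vec v)" by (intro eq_vecI) auto
qed (metis euclid_norm_zero)

lemma euclid_norm_smult: "euclid_norm (c \<cdot>\<^sub>v v) = cmod c * euclid_norm v"
proof -
  have "euclid_norm (c \<cdot>\<^sub>v v) = L2_set (\<lambda>i. cmod c * cmod (v $ i)) {..<dim_vec v}"
    unfolding euclid_norm_def by (rule L2_set_cong) (simp_all add: norm_mult)
  then show ?thesis by (simp add: euclid_norm_def L2_set_right_distrib)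
qed

lemma euclid_norm_add:
  assumes "dim_vec v = dim_vec w"
  shows "euclid_norm (v + w) \<le> euclid_norm v + euclid_norm w"
proof -
  have "euclid_norm (v + w) \<le> L2_set (\<lambda>i. cmod (v $ i) + cmod (w $ i)) {..<dim_vec w}"
    unfolding euclid_norm_def by (auto intro!: L2_set_mono simp: norm_triangle_ineq)
  also have "\<dots> \<le> euclid_norm v + euclid_norm w"
    unfolding euclid_norm_def assms by (rule L2_set_triangle_ineq)
  finally show ?thesis .
qed

lemma cmod_index_le_euclid_norm: "i < dim_vec v \<Longrightarrow> cmod (v $ i) \<le> euclid_norm v"
  unfolding euclid_norm_def by (rule member_le_L2_set) auto

lemma euclid_norm_unit_vec: "i < n \<Longrightarrow> euclid_norm (unit_vec n i) = 1"
proof -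
  assume i: "i < n"
  have "(\<Sum>j<n. (cmod (unit_vec n i $ j))\<^sup>2) = (\<Sum>j<n. if j = i then 1 else 0)"
    by (rule sum.cong) (use i in auto)
  then show ?thesis using i by (simp add: euclid_norm_def L2_set_def)
qed

text \<open>Puts the scalar product into the index form \<open>{..<n}\<close> that
  \<open>euclid_norm\<close> also uses, so that entries can be estimated directly.\<close>

lemma index_mult_mat_vec_sum:
  assumes "i < dim_row A" "dim_vec v = dim_col A"
  shows "(A *\<^sub>v v) $ i = (\<Sum>j<dim_col A. A $$ (i, j) * v $ j)"
  using assms by (simp add: scalar_prod_def lessThan_atLeast0)

text \<open>Finite dimension enters here: the entries of a vector in the unit ball have modulus at
  most 1, so the sum of all moduli of entries of \<open>A\<close> is a bound. Without it the
  supremum in \<open>op_norm\<close> could not be compared with its members.\<close>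

lemma op_norm_bdd_above:
  "bdd_above ((\<lambda>v. euclid_norm (A *\<^sub>v v)) ` {v \<in> carrier_vec (dim_col A). euclid_norm v \<le> 1})"
proof (rule bdd_aboveI2)
  fix v assume v: "v \<in> {v \<in> carrier_vec (dim_col A). euclid_norm v \<le> 1}"
  have "euclid_norm (A *\<^sub>v v) \<le> (\<Sum>i<dim_row A. cmod ((A *\<^sub>v v) $ i))"
    unfolding euclid_norm_def by (rule order_trans[OF L2_set_le_sum]) auto
  also have "\<dots> \<le> (\<Sum>i<dim_row A. \<Sum>j<dim_col A. cmod (A $$ (i, j)))"
  proof (rule sum_mono)
    fix i assume "i \<in> {..<dim_row A}"
    then have "cmod ((A *\<^sub>v v) $ i) = cmod (\<Sum>j<dim_col A. A $$ (i, j) * v $ j)"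
      using v index_mult_mat_vec_sum[of i A v] by simp
    also have "\<dots> \<le> (\<Sum>j<dim_col A. cmod (A $$ (i, j)) * cmod (v $ j))"
      by (rule order_trans[OF norm_sum]) (simp add: norm_mult)
    also have "\<dots> \<le> (\<Sum>j<dim_col A. cmod (A $$ (i, j)))"
    proof (intro sum_mono mult_left_le)
      fix j assume "j \<in> {..<dim_col A}"
      then show "cmod (v $ j) \<le> 1"
        using v cmod_index_le_euclid_norm[of j v] by auto
    qed simp
    finally show "cmod ((A *\<^sub>v v) $ i) \<le> (\<Sum>j<dim_col A. cmod (A $$ (i, j)))" .
  qed
  finally show "euclid_norm (A *\<^sub>v v) \<le> (\<Sum>i<dim_row A. \<Sum>j<dim_col A. cmod (A $$ (i, j)))" .
qed

lemma op_norm_upper: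
  assumes "v \<in> carrier_vec (dim_col A)"
  shows "euclid_norm (A *\<^sub>v v) \<le> op_norm A * euclid_norm v"
proof (cases "euclid_norm v = 0")
  case True
  then have v: "v = 0\<^sub>v (dim_col A)" using assms euclid_norm_eq_0_iff by auto
  have "A *\<^sub>v v = 0\<^sub>v (dim_row A)" unfolding v by (intro eq_vecI) auto
  then show ?thesis using True by simp
next
  case False
  then have pos: "euclid_norm v > 0" using euclid_norm_nonneg[of v] by linarith
  \<comment> \<open>Scales \<open>v\<close> to length 1, so that it becomes a competitor in the
    supremum; this is why the zero vector is split off.\<close>
  define c where "c = complex_of_real (1 / euclid_norm v)"
  have c: "cmod c = 1 / euclid_norm v" using pos by (simp add: c_def norm_divide)
  have "euclid_norm (A *\<^sub>v (c \<cdot>\<^sub>v v)) \<le> op_norm A"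
    unfolding op_norm_def using pos assms c
    by (intro cSUP_upper op_norm_bdd_above) (auto simp: euclid_norm_smult)
  also have "A *\<^sub>v (c \<cdot>\<^sub>v v) = c \<cdot>\<^sub>v (A *\<^sub>v v)"
    using assms by (intro mult_mat_vec) auto
  finally show ?thesis using pos by (simp add: euclid_norm_smult c field_simps)
qed

text \<open>Together with \<open>op_norm_upper\<close> this identifies \<open>op_norm A\<close> as
  the least bound for \<open>A\<close>; the later norm estimates for matrices rest on this pair
  instead of the supremum.\<close>

lemma op_norm_least:
  assumes "c \<ge> 0"
    and "\<And>v. v \<in> carrier_vec (dim_col A) \<Longrightarrow> euclid_norm (A *\<^sub>v v) \<le> c * euclid_norm v"
  shows "op_norm A \<le> c"
  unfolding op_norm_def
proof (rule cSUP_least)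
  have "0\<^sub>v (dim_col A) \<in> {v \<in> carrier_vec (dim_col A). euclid_norm v \<le> 1}" by simp
  then show "{v \<in> carrier_vec (dim_col A). euclid_norm v \<le> 1} \<noteq> {}" by blast
  fix v assume v: "v \<in> {v \<in> carrier_vec (dim_col A). euclid_norm v \<le> 1}"
  then have "euclid_norm (A *\<^sub>v v) \<le> c * euclid_norm v" using assms(2) by blast
  also have "\<dots> \<le> c" using v assms(1) by (simp add: mult_left_le)
  finally show "euclid_norm (A *\<^sub>v v) \<le> c" .
qed

lemma op_norm_nonneg [simp]: "op_norm A \<ge> 0"
proof -
  have "euclid_norm (A *\<^sub>v 0\<^sub>v (dim_col A)) \<le> op_norm A"
    unfolding op_norm_def by (intro cSUP_upper op_norm_bdd_above) auto
  then show ?thesis using euclid_norm_nonneg order_trans by blast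
qed

lemma op_norm_add:
  assumes "A \<in> carrier_mat m n" "B \<in> carrier_mat m n"
  shows "op_norm (A + B) \<le> op_norm A + op_norm B"
proof (rule op_norm_least)
  fix v :: "complex vec" assume "v \<in> carrier_vec (dim_col (A + B))"
  then have v: "v \<in> carrier_vec n" using assms by simp
  have "euclid_norm ((A + B) *\<^sub>v v) \<le> euclid_norm (A *\<^sub>v v) + euclid_norm (B *\<^sub>v v)"
    using assms by (simp add: add_mult_distrib_mat_vec[OF assms v] euclid_norm_add)
  also have "\<dots> \<le> op_norm A * euclid_norm v + op_norm B * euclid_norm v"
    using assms v by (intro add_mono op_norm_upper) auto
  finally show "euclid_norm ((A + B) *\<^sub>v v) \<le> (op_norm A + op_norm B) * euclid_norm v"
    by (simp add: distrib_right)
qed simp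

lemma op_norm_mult:
  assumes "A \<in> carrier_mat l m" "B \<in> carrier_mat m n"
  shows "op_norm (A * B) \<le> op_norm A * op_norm B"
proof (rule op_norm_least)
  fix v :: "complex vec" assume "v \<in> carrier_vec (dim_col (A * B))"
  then have v: "v \<in> carrier_vec n" using assms by simp
  have "euclid_norm ((A * B) *\<^sub>v v) \<le> op_norm A * euclid_norm (B *\<^sub>v v)"
    using assms v by (auto simp: assoc_mult_mat_vec[OF assms v] intro!: op_norm_upper)
  also have "\<dots> \<le> op_norm A * (op_norm B * euclid_norm v)"
    using assms v by (intro mult_left_mono op_norm_upper) auto
  finally show "euclid_norm ((A * B) *\<^sub>v v) \<le> op_norm A * op_norm B * euclid_norm v"
    by (simp add: mult.assoc)
qed simp

lemma op_norm_smult: "op_norm (c \<cdot>\<^sub>m A) = cmod c * op_norm A"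
proof -
  \<comment> \<open>Only this inequality needs an estimate. It is stated for all \<open>c\<close>
    and \<open>A\<close> so that the reverse one follows by applying it to \<open>inverse c\<close>
    and the scaled matrix.\<close>
  have le: "op_norm (c \<cdot>\<^sub>m A) \<le> cmod c * op_norm A" for c A
  proof (rule op_norm_least)
    fix v :: "complex vec" assume "v \<in> carrier_vec (dim_col (c \<cdot>\<^sub>m A))"
    then have v: "v \<in> carrier_vec (dim_col A)" by simp
    have "(c \<cdot>\<^sub>m A) *\<^sub>v v = c \<cdot>\<^sub>v (A *\<^sub>v v)"
      using v by (intro eq_vecI) auto
    then show "euclid_norm ((c \<cdot>\<^sub>m A) *\<^sub>v v) \<le> cmod c * op_norm A * euclid_norm v"
      using op_norm_upper[OF v] by (simp add: euclid_norm_smult mult.assoc mult_left_mono)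
  qed simp
  show ?thesis
  proof (cases "c = 0")
    case True
    then show ?thesis using le[of c A] op_norm_nonneg[of "c \<cdot>\<^sub>m A"] by (simp add: order_antisym)
  next
    case False
    then have "inverse c \<cdot>\<^sub>m (c \<cdot>\<^sub>m A) = A" by (intro eq_matI) auto
    with le[of "inverse c" "c \<cdot>\<^sub>m A"] have "op_norm A \<le> inverse (cmod c) * op_norm (c \<cdot>\<^sub>m A)"
      by (simp add: norm_inverse)
    then show ?thesis using le[of c A] False by (simp add: field_simps)
  qed
qed

lemma op_norm_zero [simp]: "op_norm (0\<^sub>m m n) = 0"
  using op_norm_smult[of 0 "0\<^sub>m m n"] by simp

lemma mat_minus_eq_add_smult:
  fixes A :: "complex mat"
  assumes "A \<in> carrier_mat m n" "B \<in> carrier_mat m n"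
  shows "A - B = A + (-1) \<cdot>\<^sub>m B"
  using assms by (intro eq_matI) auto

lemma op_norm_diff:
  assumes "A \<in> carrier_mat m n" "B \<in> carrier_mat m n"
  shows "op_norm (A - B) \<le> op_norm A + op_norm B"
  using op_norm_add[of A m n "(-1) \<cdot>\<^sub>m B"] assms
  by (simp add: mat_minus_eq_add_smult[OF assms] op_norm_smult)

lemma op_norm_diff_commute:
  assumes "A \<in> carrier_mat m n" "B \<in> carrier_mat m n"
  shows "op_norm (A - B) = op_norm (B - A)"
proof -
  have "A - B = (-1) \<cdot>\<^sub>m (B - A)" using assms by (intro eq_matI) auto
  then show ?thesis by (simp add: op_norm_smult)
qed

text \<open>Testing \<open>A\<close> on a unit vector exhibits a column, whose length dominates each
  of its entries. This yields definiteness of the norm and contractivity of the diagonal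
  expectation.\<close>

lemma cmod_entry_le_op_norm:
  assumes "i < dim_row A" "j < dim_col A"
  shows "cmod (A $$ (i, j)) \<le> op_norm A"
proof -
  have "cmod (A $$ (i, j)) = cmod ((A *\<^sub>v unit_vec (dim_col A) j) $ i)"
    using assms by simp
  also have "\<dots> \<le> euclid_norm (A *\<^sub>v unit_vec (dim_col A) j)"
    using assms by (intro cmod_index_le_euclid_norm) simp
  also have "\<dots> \<le> op_norm A"
    using op_norm_upper[of "unit_vec (dim_col A) j" A] euclid_norm_unit_vec[OF assms(2)] by simp
  finally show ?thesis .
qed

lemma op_norm_eq_0_iff: "op_norm A = 0 \<longleftrightarrow> A = 0\<^sub>m (dim_row A) (dim_col A)"
proof
  assume "op_norm A = 0"
  then show "A = 0\<^sub>m (dim_row A) (dim_col A)"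
    using cmod_entry_le_op_norm[of _ A] by (intro eq_matI) auto
qed (metis op_norm_zero)

lemma op_norm_mat_diag:
  assumes "c \<ge> 0" "\<And>i. i < n \<Longrightarrow> cmod (f i) \<le> c"
  shows "op_norm (mat_diag n f) \<le> c"
proof (rule op_norm_least)
  fix v :: "complex vec" assume "v \<in> carrier_vec (dim_col (mat_diag n f))"
  then have v: "dim_vec v = n" by (simp add: mat_diag_def)
  have ent: "(mat_diag n f *\<^sub>v v) $ i = f i * v $ i" if "i < n" for i
    using that v index_mult_mat_vec_sum[of i "mat_diag n f" v]
    by (simp add: mat_diag_def if_distrib if_distribR cong: if_cong)
  have "euclid_norm (mat_diag n f *\<^sub>v v) = L2_set (\<lambda>i. cmod (f i) * cmod (v $ i)) {..<n}"
    unfolding euclid_norm_def by (rule L2_set_cong) (simp_all add: ent norm_mult, simp add: mat_diag_def)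
  also have "\<dots> \<le> L2_set (\<lambda>i. c * cmod (v $ i)) {..<n}"
    using assms(2) by (intro L2_set_mono mult_right_mono) auto
  finally show "euclid_norm (mat_diag n f *\<^sub>v v) \<le> c * euclid_norm v"
    using assms(1) v by (simp add: euclid_norm_def L2_set_right_distrib)
qed fact

section \<open>Adjoints of matrices\<close>

lemma mat_adjoint_carrier: "A \<in> carrier_mat m n \<Longrightarrow> mat_adjoint A \<in> carrier_mat n m"
  by (auto simp: mat_adjoint_def)

lemma mat_adjoint_index:
  assumes "A \<in> carrier_mat m n" "i < m" "j < n"
  shows "mat_adjoint A $$ (j, i) = cnj (A $$ (i, j))"
  using assms by (simp add: mat_adjoint_def mat_of_rows_def)

text \<open>The usual \<open>\<parallel>A\<^sup>* v\<parallel>\<^sup>2 = \<langle>v, A A\<^sup>* v\<rangle> \<le> \<parallel>v\<parallel> \<parallel>A\<parallel> \<parallel>A\<^sup>* v\<parallel>\<close>.\<close>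

lemma op_norm_adjoint_le:
  assumes A: "A \<in> carrier_mat m n"
  shows "op_norm (mat_adjoint A) \<le> op_norm A"
proof (rule op_norm_least)
  fix v :: "complex vec" assume "v \<in> carrier_vec (dim_col (mat_adjoint A))"
  then have v: "dim_vec v = m" using mat_adjoint_carrier[OF A] by simp
  define w where "w = mat_adjoint A *\<^sub>v v"
  have w: "dim_vec w = n" using mat_adjoint_carrier[OF A] by (simp add: w_def)
  have went: "w $ j = (\<Sum>i<m. cnj (A $$ (i, j)) * v $ i)" if "j < n" for j
    using that v mat_adjoint_carrier[OF A] index_mult_mat_vec_sum[of j "mat_adjoint A" v]
    by (simp add: w_def mat_adjoint_index[OF A])
  have Aw: "(A *\<^sub>v w) $ i = (\<Sum>j<n. A $$ (i, j) * w $ j)" if "i < m" for i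
    using that w A index_mult_mat_vec_sum[of i A w] by simp
  have "complex_of_real ((euclid_norm w)\<^sup>2) = (\<Sum>j<n. w $ j * cnj (w $ j))"
    by (simp add: euclid_norm_def L2_set_def w sum_nonneg flip: complex_norm_square)
  also have "\<dots> = (\<Sum>j<n. \<Sum>i<m. v $ i * cnj (A $$ (i, j) * w $ j))"
  proof (rule sum.cong)
    fix j assume "j \<in> {..<n}"
    then have "w $ j * cnj (w $ j) = (\<Sum>i<m. cnj (A $$ (i, j)) * v $ i) * cnj (w $ j)"
      using went by auto
    also have "\<dots> = (\<Sum>i<m. v $ i * cnj (A $$ (i, j) * w $ j))"
      by (simp add: sum_distrib_left sum_distrib_right mult_ac)
    finally show "w $ j * cnj (w $ j) = (\<Sum>i<m. v $ i * cnj (A $$ (i, j) * w $ j))" .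
  qed simp
  also have "\<dots> = (\<Sum>i<m. v $ i * cnj ((A *\<^sub>v w) $ i))"
    by (subst sum.swap) (simp add: Aw sum_distrib_left)
  finally have "(euclid_norm w)\<^sup>2 = cmod (\<Sum>i<m. v $ i * cnj ((A *\<^sub>v w) $ i))"
    by (metis abs_power2 norm_of_real real_norm_def)
  also have "\<dots> \<le> (\<Sum>i<m. \<bar>cmod (v $ i)\<bar> * \<bar>cmod ((A *\<^sub>v w) $ i)\<bar>)"
    by (rule order_trans[OF norm_sum]) (simp add: norm_mult)
  also have "\<dots> \<le> euclid_norm v * euclid_norm (A *\<^sub>v w)"
    using L2_set_mult_ineq[of "\<lambda>i. cmod (v $ i)" "\<lambda>i. cmod ((A *\<^sub>v w) $ i)" "{..<m}"] v A
    by (simp add: euclid_norm_def)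
  also have "\<dots> \<le> euclid_norm v * (op_norm A * euclid_norm w)"
    using w A by (intro mult_left_mono op_norm_upper) (auto intro: carrier_vecI)
  finally have "euclid_norm w * euclid_norm w \<le> (op_norm A * euclid_norm v) * euclid_norm w"
    by (simp add: power2_eq_square mult_ac)
  then show "euclid_norm (mat_adjoint A *\<^sub>v v) \<le> op_norm A * euclid_norm v"
    \<comment> \<open>Cancelling a factor \<open>euclid_norm w\<close> requires it to be nonzero; if
      it vanishes, the claim is trivial.\<close>
    using euclid_norm_nonneg[of w] unfolding w_def[symmetric]
    by (cases "euclid_norm w = 0") auto
qed simp

section \<open>The algebra of bounded matrix sequences\<close>

abbreviation LA :: "(complex, mat_seq) module" where "LA \<equiv> linf_alg"

lemma linf_alg_carrier_iff:
  "a \<in> carrier LA \<longleftrightarrow>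
     a \<in> extensional {2..} \<and> (\<forall>n\<ge>2. a n \<in> carrier_mat n n) \<and> (\<exists>B. \<forall>n\<ge>2. op_norm (a n) \<le> B)"
  by (auto simp: linf_alg_def PiE_def Pi_def bdd_above_def)

lemma linf_alg_carrierD:
  assumes "a \<in> carrier LA" "n \<ge> 2"
  shows "a n \<in> carrier_mat n n" "dim_row (a n) = n" "dim_col (a n) = n"
  using assms by (auto simp: linf_alg_carrier_iff)

lemma linf_alg_carrierI:
  assumes "\<And>n. n \<ge> 2 \<Longrightarrow> f n \<in> carrier_mat n n" "\<And>n. n \<ge> 2 \<Longrightarrow> op_norm (f n) \<le> B"
  shows "(\<lambda>n\<in>{2..}. f n) \<in> carrier LA"
  using assms by (auto simp: linf_alg_carrier_iff)

text \<open>Carrier elements are extensional, so the values at 0 and 1 are fixed; algebraic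
  identities thereby reduce to identities between matrices.\<close>

lemma linf_alg_eqI:
  assumes "a \<in> carrier LA" "b \<in> carrier LA" "\<And>n. n \<ge> 2 \<Longrightarrow> a n = b n"
  shows "a = b"
  using assms by (auto simp: linf_alg_carrier_iff intro: extensionalityI)

lemma linf_alg_simps:
  "(a \<otimes>\<^bsub>LA\<^esub> b) = (\<lambda>n\<in>{2..}. a n * b n)"
  "\<one>\<^bsub>LA\<^esub> = (\<lambda>n\<in>{2..}. 1\<^sub>m n)"
  "\<zero>\<^bsub>LA\<^esub> = (\<lambda>n\<in>{2..}. 0\<^sub>m n n)"
  "(a \<oplus>\<^bsub>LA\<^esub> b) = (\<lambda>n\<in>{2..}. a n + b n)"
  "(c \<odot>\<^bsub>LA\<^esub> a) = (\<lambda>n\<in>{2..}. c \<cdot>\<^sub>m a n)"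
  by (simp_all add: linf_alg_def)

lemma op_norm_le_linf_norm:
  assumes "a \<in> carrier LA" "n \<ge> 2"
  shows "op_norm (a n) \<le> linf_norm a"
  unfolding linf_norm_def using assms
  by (intro cSUP_upper) (auto simp: linf_alg_def)

lemma linf_norm_least:
  assumes "\<And>n. n \<ge> 2 \<Longrightarrow> op_norm (a n) \<le> B"
  shows "linf_norm a \<le> B"
  unfolding linf_norm_def using assms by (intro cSUP_least) auto

lemma linf_norm_nonneg: "a \<in> carrier LA \<Longrightarrow> linf_norm a \<ge> 0"
  \<comment> \<open>The index set starts at 2, so coordinate 2 shows that the supremum dominates a
    nonnegative number.\<close>
  using op_norm_le_linf_norm[of a 2] op_norm_nonneg[of "a 2"] by linarith

lemma linf_add:
  assumes "a \<in> carrier LA" "b \<in> carrier LA"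
  shows "a \<oplus>\<^bsub>LA\<^esub> b \<in> carrier LA" "linf_norm (a \<oplus>\<^bsub>LA\<^esub> b) \<le> linf_norm a + linf_norm b"
proof -
  have *: "op_norm (a n + b n) \<le> linf_norm a + linf_norm b" if n: "n \<ge> 2" for n
    using op_norm_add[OF assms[THEN linf_alg_carrierD(1), OF n]]
      op_norm_le_linf_norm[OF assms(1) n] op_norm_le_linf_norm[OF assms(2) n] by linarith
  then show "a \<oplus>\<^bsub>LA\<^esub> b \<in> carrier LA"
    unfolding linf_alg_simps using assms by (intro linf_alg_carrierI) (auto dest: linf_alg_carrierD)
  show "linf_norm (a \<oplus>\<^bsub>LA\<^esub> b) \<le> linf_norm a + linf_norm b"
    using * by (intro linf_norm_least) (simp add: linf_alg_simps)
qed

lemma linf_mult: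
  assumes "a \<in> carrier LA" "b \<in> carrier LA"
  shows "a \<otimes>\<^bsub>LA\<^esub> b \<in> carrier LA" "linf_norm (a \<otimes>\<^bsub>LA\<^esub> b) \<le> linf_norm a * linf_norm b"
proof -
  have *: "op_norm (a n * b n) \<le> linf_norm a * linf_norm b" if n: "n \<ge> 2" for n
    using op_norm_mult[OF assms[THEN linf_alg_carrierD(1), OF n]] linf_norm_nonneg[OF assms(1)]
      mult_mono[OF op_norm_le_linf_norm[OF assms(1) n] op_norm_le_linf_norm[OF assms(2) n]]
    by fastforce
  then show "a \<otimes>\<^bsub>LA\<^esub> b \<in> carrier LA"
    unfolding linf_alg_simps using assms
    by (intro linf_alg_carrierI) (auto intro: mult_carrier_mat linf_alg_carrierD(1))
  show "linf_norm (a \<otimes>\<^bsub>LA\<^esub> b) \<le> linf_norm a * linf_norm b"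
    using * by (intro linf_norm_least) (simp add: linf_alg_simps)
qed

lemma linf_smult_closed: "a \<in> carrier LA \<Longrightarrow> c \<odot>\<^bsub>LA\<^esub> a \<in> carrier LA"
  unfolding linf_alg_simps
  by (intro linf_alg_carrierI[where B = "cmod c * linf_norm a"])
     (auto simp: op_norm_smult intro!: mult_left_mono op_norm_le_linf_norm dest: linf_alg_carrierD)

lemma linf_norm_smult_le:
  assumes "a \<in> carrier LA"
  shows "linf_norm (c \<odot>\<^bsub>LA\<^esub> a) \<le> cmod c * linf_norm a"
  by (rule linf_norm_least)
     (use assms in \<open>auto simp: linf_alg_simps op_norm_smult intro!: mult_left_mono op_norm_le_linf_norm\<close>)

lemma linf_zero: "\<zero>\<^bsub>LA\<^esub> \<in> carrier LA" "linf_norm \<zero>\<^bsub>LA\<^esub> = 0"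
proof -
  show *: "\<zero>\<^bsub>LA\<^esub> \<in> carrier LA"
    unfolding linf_alg_simps by (intro linf_alg_carrierI[where B = 0]) auto
  have "linf_norm \<zero>\<^bsub>LA\<^esub> \<le> 0" by (rule linf_norm_least) (simp add: linf_alg_simps)
  with linf_norm_nonneg[OF *] show "linf_norm \<zero>\<^bsub>LA\<^esub> = 0" by linarith
qed

lemma linf_norm_eq_0D:
  assumes "a \<in> carrier LA" "linf_norm a = 0"
  shows "a = \<zero>\<^bsub>LA\<^esub>"
proof (rule linf_alg_eqI[OF assms(1) linf_zero(1)])
  fix n :: nat assume n: "n \<ge> 2"
  then have "op_norm (a n) = 0"
    using op_norm_le_linf_norm[OF assms(1) n] assms(2) op_norm_nonneg[of "a n"] by linarith
  then show "a n = \<zero>\<^bsub>LA\<^esub> n"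
    using linf_alg_carrierD[OF assms(1) n] n op_norm_eq_0_iff[of "a n"] by (simp add: linf_alg_simps)
qed

text \<open>Exhibits a concrete additive inverse. It serves three times: for the group axioms, for
  computing \<open>\<ominus>\<close> coordinatewise, and for seeing that compact elements have
  quotient norm 0.\<close>

lemma linf_smult_neg_one_add:
  assumes "a \<in> carrier LA"
  shows "((-1) \<odot>\<^bsub>LA\<^esub> a) \<oplus>\<^bsub>LA\<^esub> a = \<zero>\<^bsub>LA\<^esub>"
proof (rule linf_alg_eqI)
  fix n :: nat assume n: "n \<ge> 2"
  then show "(((-1) \<odot>\<^bsub>LA\<^esub> a) \<oplus>\<^bsub>LA\<^esub> a) n = \<zero>\<^bsub>LA\<^esub> n"
    using linf_alg_carrierD[OF assms n] by (auto simp: linf_alg_simps)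
qed (use assms in \<open>auto intro: linf_add linf_zero linf_smult_closed\<close>)

interpretation LA: abelian_group linf_alg
proof (rule abelian_groupI)
  show "\<exists>y\<in>carrier LA. y \<oplus>\<^bsub>LA\<^esub> x = \<zero>\<^bsub>LA\<^esub>" if "x \<in> carrier LA" for x
    using that linf_smult_neg_one_add linf_smult_closed by blast
  show "x \<oplus>\<^bsub>LA\<^esub> y \<oplus>\<^bsub>LA\<^esub> z = x \<oplus>\<^bsub>LA\<^esub> (y \<oplus>\<^bsub>LA\<^esub> z)"
    if "x \<in> carrier LA" "y \<in> carrier LA" "z \<in> carrier LA" for x y z
    by (rule linf_alg_eqI)
       (use that in \<open>auto simp: linf_add(1), auto simp: linf_alg_simps intro: assoc_add_mat linf_alg_carrierD(1)\<close>)
  show "x \<oplus>\<^bsub>LA\<^esub> y = y \<oplus>\<^bsub>LA\<^esub> x" if "x \<in> carrier LA" "y \<in> carrier LA" for x y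
    by (rule linf_alg_eqI)
       (use that in \<open>auto simp: linf_add(1), auto simp: linf_alg_simps intro: comm_add_mat linf_alg_carrierD(1)\<close>)
  show "\<zero>\<^bsub>LA\<^esub> \<oplus>\<^bsub>LA\<^esub> x = x" if "x \<in> carrier LA" for x
    by (rule linf_alg_eqI)
       (use that in \<open>auto simp: linf_add(1) linf_zero(1), auto simp: linf_alg_simps intro: left_add_zero_mat linf_alg_carrierD(1)\<close>)
qed (auto intro: linf_add linf_zero)

text \<open>HOL-Algebra defines subtraction through an abstract inverse; uniqueness of inverses
  identifies it with multiplication by -1, which can be evaluated at \<open>n\<close>.\<close>

lemma linf_minus_index:
  assumes "a \<in> carrier LA" "b \<in> carrier LA" "n \<ge> 2"
  shows "(a \<ominus>\<^bsub>LA\<^esub> b) n = a n - b n"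
proof -
  have "\<ominus>\<^bsub>LA\<^esub> b = (-1) \<odot>\<^bsub>LA\<^esub> b"
    using assms by (intro LA.minus_equality linf_smult_neg_one_add linf_smult_closed)
  then show ?thesis
    using assms mat_minus_eq_add_smult[of "a n" n n "b n"] linf_alg_carrierD(1)[OF _ assms(3)]
    by (simp add: a_minus_def linf_alg_simps)
qed

lemma linf_minus_eq_restrict:
  assumes "a \<in> carrier LA" "b \<in> carrier LA"
  shows "a \<ominus>\<^bsub>LA\<^esub> b = (\<lambda>n\<in>{2..}. a n - b n)"
proof (rule extensionalityI)
  show "a \<ominus>\<^bsub>LA\<^esub> b \<in> extensional {2..}"
    using LA.minus_closed[OF assms] by (simp add: linf_alg_carrier_iff)
qed (use assms linf_minus_index in auto)

lemma linf_norm_minus_le: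
  assumes "a \<in> carrier LA" "b \<in> carrier LA"
  shows "linf_norm (a \<ominus>\<^bsub>LA\<^esub> b) \<le> linf_norm a + linf_norm b"
proof (rule linf_norm_least)
  fix n :: nat assume n: "n \<ge> 2"
  show "op_norm ((a \<ominus>\<^bsub>LA\<^esub> b) n) \<le> linf_norm a + linf_norm b"
    using op_norm_diff[OF assms[THEN linf_alg_carrierD(1), OF n]] linf_minus_index[OF assms n]
      op_norm_le_linf_norm[OF assms(1) n] op_norm_le_linf_norm[OF assms(2) n] by simp
qed

lemma linf_norm_minus_commute:
  assumes "a \<in> carrier LA" "b \<in> carrier LA"
  shows "linf_norm (a \<ominus>\<^bsub>LA\<^esub> b) = linf_norm (b \<ominus>\<^bsub>LA\<^esub> a)"
  unfolding linf_norm_def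
  using assms by (intro SUP_cong) (auto simp: linf_minus_index intro: op_norm_diff_commute linf_alg_carrierD)

text \<open>The telescoping identity behind the triangle inequality of
  \<open>linf_dist\<close>.\<close>

lemma linf_minus_add_minus:
  assumes "a \<in> carrier LA" "b \<in> carrier LA" "c \<in> carrier LA"
  shows "(a \<ominus>\<^bsub>LA\<^esub> b) \<oplus>\<^bsub>LA\<^esub> (b \<ominus>\<^bsub>LA\<^esub> c) = a \<ominus>\<^bsub>LA\<^esub> c"
  using assms LA.r_neg1[of b "\<ominus>\<^bsub>LA\<^esub> c"] by (simp add: a_minus_def LA.a_assoc LA.r_neg2 LA.r_neg1)

lemma linf_minus_eq_zero_iff:
  assumes "a \<in> carrier LA" "b \<in> carrier LA"
  shows "a \<ominus>\<^bsub>LA\<^esub> b = \<zero>\<^bsub>LA\<^esub> \<longleftrightarrow> a = b"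
  using assms LA.minus_equality[of a "\<ominus>\<^bsub>LA\<^esub> b"] by (auto simp: a_minus_def LA.r_neg)

lemma linf_dist_eq: "a \<in> carrier LA \<Longrightarrow> b \<in> carrier LA \<Longrightarrow> linf_dist a b = linf_norm (a \<ominus>\<^bsub>LA\<^esub> b)"
  by (simp add: linf_dist_def)

interpretation LA: Metric_space "carrier linf_alg" linf_dist
proof
  show "0 \<le> linf_dist x y" for x y
    by (simp add: linf_dist_def linf_norm_nonneg)
  show "linf_dist x y = linf_dist y x" for x y
    by (simp add: linf_dist_def linf_norm_minus_commute)
  show "linf_dist x y = 0 \<longleftrightarrow> x = y" if "x \<in> carrier LA" "y \<in> carrier LA" for x y
    using that
    by (metis linf_dist_eq linf_norm_eq_0D linf_minus_eq_zero_iff linf_zero(2) LA.minus_closed)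
  show "linf_dist x z \<le> linf_dist x y + linf_dist y z"
    if "x \<in> carrier LA" "y \<in> carrier LA" "z \<in> carrier LA" for x y z
    using that linf_add(2)[of "x \<ominus>\<^bsub>LA\<^esub> y" "y \<ominus>\<^bsub>LA\<^esub> z"]
    by (simp add: linf_dist_eq linf_minus_add_minus)
qed

section \<open>Adjoint sequences and the positive cone\<close>

lemma linf_star_closed:
  assumes "a \<in> carrier LA"
  shows "linf_star a \<in> carrier LA"
  unfolding linf_star_def
proof (rule linf_alg_carrierI)
  fix n :: nat assume n: "n \<ge> 2"
  show "mat_adjoint (a n) \<in> carrier_mat n n"
    using mat_adjoint_carrier linf_alg_carrierD[OF assms n] by blast
  show "op_norm (mat_adjoint (a n)) \<le> linf_norm a"
    using op_norm_adjoint_le[OF linf_alg_carrierD(1)[OF assms n]] op_norm_le_linf_norm[OF assms n]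
    by linarith
qed

lemma linf_pos_subset: "linf_pos \<subseteq> carrier LA"
  by (auto simp: linf_pos_def intro!: linf_mult linf_star_closed)

text \<open>Absorb the square root of \<open>c\<close> into the factor: if \<open>x\<close> is
  \<open>b* b\<close>, then \<open>c x\<close> is \<open>(s b)* (s b)\<close> with \<open>s\<close>
  the real, hence self-conjugate, root.\<close>

lemma linf_pos_smult:
  assumes "x \<in> linf_pos" "c \<ge> 0"
  shows "complex_of_real c \<odot>\<^bsub>LA\<^esub> x \<in> linf_pos"
proof -
  obtain b where b: "b \<in> carrier LA" "x = linf_star b \<otimes>\<^bsub>LA\<^esub> b"
    using assms by (auto simp: linf_pos_def)
  define s where "s = complex_of_real (sqrt c)"
  have ss: "s * s = complex_of_real c" "cnj s = s"
    using assms(2) by (simp_all add: s_def flip: of_real_mult)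
  have "complex_of_real c \<odot>\<^bsub>LA\<^esub> x = linf_star (s \<odot>\<^bsub>LA\<^esub> b) \<otimes>\<^bsub>LA\<^esub> (s \<odot>\<^bsub>LA\<^esub> b)"
  proof (rule extensionalityI[of _ "{2..}"])
    fix n :: nat assume "n \<in> {2..}"
    then have n: "n \<ge> 2" by simp
    note bn = linf_alg_carrierD[OF b(1) n]
    have "mat_adjoint (s \<cdot>\<^sub>m b n) = s \<cdot>\<^sub>m mat_adjoint (b n)"
      using bn mat_adjoint_carrier[OF bn(1)] mat_adjoint_carrier[of "s \<cdot>\<^sub>m b n" n n] ss(2)
      by (intro eq_matI) (auto simp: mat_adjoint_index[of _ n n])
    moreover have "(s \<cdot>\<^sub>m mat_adjoint (b n)) * (s \<cdot>\<^sub>m b n) = (s * s) \<cdot>\<^sub>m (mat_adjoint (b n) * b n)"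
      using mat_adjoint_carrier[OF bn(1)] bn
      by (intro eq_matI) auto
    ultimately show "(complex_of_real c \<odot>\<^bsub>LA\<^esub> x) n
        = (linf_star (s \<odot>\<^bsub>LA\<^esub> b) \<otimes>\<^bsub>LA\<^esub> (s \<odot>\<^bsub>LA\<^esub> b)) n"
      using n ss by (simp add: b(2) linf_alg_simps linf_star_def)
  qed (auto simp: linf_alg_simps)
  then show ?thesis
    using linf_smult_closed[OF b(1)] by (auto simp: linf_pos_def)
qed

section \<open>The quotient norm\<close>

lemma linf_norm_block_unit_mult:
  assumes "a \<in> carrier LA" "n \<ge> 2"
  shows "linf_norm (block_unit n \<otimes>\<^bsub>LA\<^esub> a) = op_norm (a n)"
proof (rule antisym)
  have ent: "(block_unit n \<otimes>\<^bsub>LA\<^esub> a) k = (if k = n then a n else 0\<^sub>m k k)" if "k \<ge> 2" for k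
    using that linf_alg_carrierD(1)[OF assms(1) that]
    by (auto simp: linf_alg_simps block_unit_def)
  show "linf_norm (block_unit n \<otimes>\<^bsub>LA\<^esub> a) \<le> op_norm (a n)"
    by (rule linf_norm_least) (simp add: ent)
  have "block_unit n \<otimes>\<^bsub>LA\<^esub> a = (\<lambda>k\<in>{2..}. if k = n then a n else 0\<^sub>m k k)"
    by (rule extensionalityI[of _ "{2..}"]) (use ent in \<open>auto simp: linf_alg_simps\<close>)
  also have "\<dots> \<in> carrier LA"
    by (rule linf_alg_carrierI[where B = "op_norm (a n)"]) (auto dest: linf_alg_carrierD[OF assms(1)])
  \<comment> \<open>Carrier membership is what makes the supremum bounded, so the single block may
    be compared with it.\<close>
  finally show "op_norm (a n) \<le> linf_norm (block_unit n \<otimes>\<^bsub>LA\<^esub> a)"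
    using op_norm_le_linf_norm[OF _ assms(2), of "block_unit n \<otimes>\<^bsub>LA\<^esub> a"] ent[OF assms(2)] by simp
qed

lemma compact_ideal_iff:
  "a \<in> compact_ideal \<longleftrightarrow> a \<in> carrier LA \<and> (\<lambda>n. op_norm (a n)) \<longlonglongrightarrow> 0"
proof -
  have "(\<lambda>n. linf_norm (block_unit n \<otimes>\<^bsub>LA\<^esub> a)) \<longlonglongrightarrow> 0 \<longleftrightarrow> (\<lambda>n. op_norm (a n)) \<longlonglongrightarrow> 0"
    if "a \<in> carrier LA"
    using that linf_norm_block_unit_mult
    \<comment> \<open>For \<open>n < 2\<close> the block unit is zero while \<open>a n\<close> is
      \<open>undefined\<close>; the two sequences agree from 2 on, which is all a limit
      sees.\<close>
    by (intro filterlim_cong) (auto simp: eventually_sequentially)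
  then show ?thesis by (auto simp: compact_ideal_def)
qed

lemma compact_ideal_subset: "compact_ideal \<subseteq> carrier LA"
  by (auto simp: compact_ideal_iff)

lemma compact_ideal_smult:
  assumes "a \<in> compact_ideal"
  shows "c \<odot>\<^bsub>LA\<^esub> a \<in> compact_ideal"
proof -
  have "(\<lambda>n. cmod c * op_norm (a n)) \<longlonglongrightarrow> 0"
    using assms tendsto_mult_right_zero by (auto simp: compact_ideal_iff)
  \<comment> \<open>The scaled sequence is \<open>undefined\<close> at 0 and 1, so the norm formula
    holds only eventually.\<close>
  moreover have "\<forall>\<^sub>F n in sequentially. cmod c * op_norm (a n) = op_norm ((c \<odot>\<^bsub>LA\<^esub> a) n)"
    by (auto simp: eventually_sequentially linf_alg_simps op_norm_smult)
  ultimately have "(\<lambda>n. op_norm ((c \<odot>\<^bsub>LA\<^esub> a) n)) \<longlonglongrightarrow> 0"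
    by (rule Lim_transform_eventually)
  then show ?thesis
    using assms linf_smult_closed by (auto simp: compact_ideal_iff)
qed

text \<open>Guarantees that the infimum defining the quotient norm runs over a nonempty set.\<close>

lemma zero_mem_compact_ideal: "\<zero>\<^bsub>LA\<^esub> \<in> compact_ideal"
proof -
  have "\<forall>\<^sub>F n in sequentially. op_norm (\<zero>\<^bsub>LA\<^esub> n) = 0"
    by (auto simp: eventually_sequentially linf_alg_simps)
  then show ?thesis by (simp add: compact_ideal_iff linf_zero tendsto_eventually)
qed

abbreviation qnorm :: "mat_seq \<Rightarrow> real" where "qnorm a \<equiv> quot_norm (quot_map a)"

lemma qnorm_eq: "qnorm a = (INF k\<in>compact_ideal. linf_norm (k \<oplus>\<^bsub>LA\<^esub> a))"
proof -
  have "quot_map a = (\<lambda>k. k \<oplus>\<^bsub>LA\<^esub> a) ` compact_ideal"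
    by (auto simp: quot_map_def a_r_coset_def')
  then show ?thesis by (simp add: quot_norm_def image_image)
qed

lemma qnorm_least:
  assumes "\<And>k. k \<in> compact_ideal \<Longrightarrow> B \<le> linf_norm (k \<oplus>\<^bsub>LA\<^esub> a)"
  shows "B \<le> qnorm a"
  unfolding qnorm_eq using assms zero_mem_compact_ideal by (intro cINF_greatest) auto

lemma qnorm_nonneg: "a \<in> carrier LA \<Longrightarrow> qnorm a \<ge> 0"
  using compact_ideal_subset by (intro qnorm_least linf_norm_nonneg linf_add(1)) auto

lemma qnorm_le:
  assumes "a \<in> carrier LA" "k \<in> compact_ideal"
  shows "qnorm a \<le> linf_norm (k \<oplus>\<^bsub>LA\<^esub> a)"
  unfolding qnorm_eq
proof (rule cINF_lower[OF _ assms(2)])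
  show "bdd_below ((\<lambda>k. linf_norm (k \<oplus>\<^bsub>LA\<^esub> a)) ` compact_ideal)"
    using compact_ideal_subset assms(1)
    by (intro bdd_belowI2[where m = 0] linf_norm_nonneg linf_add(1)) auto
qed

text \<open>The same compact \<open>k\<close> is a competitor for \<open>a\<close> and for
  \<open>b\<close>, and the two translates differ by \<open>a \<ominus> b\<close>; taking the
  infimum over \<open>k\<close> keeps the error term. This is the Lipschitz property of the quotient
  norm.\<close>

lemma qnorm_le_add:
  assumes "a \<in> carrier LA" "b \<in> carrier LA"
  shows "qnorm a \<le> qnorm b + linf_norm (a \<ominus>\<^bsub>LA\<^esub> b)"
proof -
  have "qnorm a - linf_norm (a \<ominus>\<^bsub>LA\<^esub> b) \<le> qnorm b"
  proof (rule qnorm_least)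
    fix k assume k: "k \<in> compact_ideal"
    then have kc: "k \<in> carrier LA" using compact_ideal_subset by auto
    have "a = b \<oplus>\<^bsub>LA\<^esub> (a \<ominus>\<^bsub>LA\<^esub> b)"
      using assms by (simp add: a_minus_def LA.a_lcomm[of b a] LA.r_neg)
    then have "k \<oplus>\<^bsub>LA\<^esub> a = (k \<oplus>\<^bsub>LA\<^esub> b) \<oplus>\<^bsub>LA\<^esub> (a \<ominus>\<^bsub>LA\<^esub> b)"
      using assms kc by (metis LA.a_assoc LA.minus_closed)
    then have "linf_norm (k \<oplus>\<^bsub>LA\<^esub> a) \<le> linf_norm (k \<oplus>\<^bsub>LA\<^esub> b) + linf_norm (a \<ominus>\<^bsub>LA\<^esub> b)"
      using assms kc linf_add by simp
    then show "qnorm a - linf_norm (a \<ominus>\<^bsub>LA\<^esub> b) \<le> linf_norm (k \<oplus>\<^bsub>LA\<^esub> b)"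
      using qnorm_le[OF assms(1) k] by linarith
  qed
  then show ?thesis by linarith
qed

lemma smult_inverse:
  assumes "a \<in> carrier LA" "c \<noteq> 0"
  shows "inverse c \<odot>\<^bsub>LA\<^esub> (c \<odot>\<^bsub>LA\<^esub> a) = a"
  by (rule linf_alg_eqI)
     (use assms in \<open>auto simp: linf_smult_closed, auto simp: linf_alg_simps intro!: eq_matI\<close>)

text \<open>Scaling maps the compact ideal into itself, so \<open>k\<close> may be replaced by its
  multiple by \<open>c\<close>. As for \<open>op_norm\<close>, the reverse inequality comes from
  \<open>inverse c\<close>.\<close>

lemma qnorm_smult:
  assumes "a \<in> carrier LA" "c \<noteq> 0"
  shows "qnorm (c \<odot>\<^bsub>LA\<^esub> a) = cmod c * qnorm a"
proof -
  have le: "qnorm (c \<odot>\<^bsub>LA\<^esub> a) \<le> cmod c * qnorm a" if "a \<in> carrier LA" "c \<noteq> 0" for a c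
  proof -
    have "qnorm (c \<odot>\<^bsub>LA\<^esub> a) / cmod c \<le> qnorm a"
    proof (rule qnorm_least)
      fix k assume k: "k \<in> compact_ideal"
      then have kc: "k \<in> carrier LA" using compact_ideal_subset by auto
      have "qnorm (c \<odot>\<^bsub>LA\<^esub> a) \<le> linf_norm ((c \<odot>\<^bsub>LA\<^esub> k) \<oplus>\<^bsub>LA\<^esub> (c \<odot>\<^bsub>LA\<^esub> a))"
        using that k by (intro qnorm_le linf_smult_closed compact_ideal_smult)
      also have "(c \<odot>\<^bsub>LA\<^esub> k) \<oplus>\<^bsub>LA\<^esub> (c \<odot>\<^bsub>LA\<^esub> a) = c \<odot>\<^bsub>LA\<^esub> (k \<oplus>\<^bsub>LA\<^esub> a)"
        by (rule linf_alg_eqI)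
           (use that kc in \<open>auto simp: linf_smult_closed linf_add,
             auto simp: linf_alg_simps intro: add_smult_distrib_left_mat[symmetric] linf_alg_carrierD(1)\<close>)
      also have "linf_norm \<dots> \<le> cmod c * linf_norm (k \<oplus>\<^bsub>LA\<^esub> a)"
        using that kc by (intro linf_norm_smult_le linf_add)
      finally show "qnorm (c \<odot>\<^bsub>LA\<^esub> a) / cmod c \<le> linf_norm (k \<oplus>\<^bsub>LA\<^esub> a)"
        using that(2) by (simp add: field_simps)
    qed
    then show ?thesis using that(2) by (simp add: field_simps)
  qed
  have "qnorm a \<le> cmod (inverse c) * qnorm (c \<odot>\<^bsub>LA\<^esub> a)"
    using le[of "c \<odot>\<^bsub>LA\<^esub> a" "inverse c"] assms by (simp add: smult_inverse linf_smult_closed)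
  then have "cmod c * qnorm a \<le> qnorm (c \<odot>\<^bsub>LA\<^esub> a)"
    using assms(2) by (simp add: norm_inverse inverse_eq_divide norm_divide field_simps)
  with le[OF assms] show ?thesis by linarith
qed

text \<open>The negative of \<open>a\<close> is itself compact and cancels \<open>a\<close> in the
  infimum. Used in contrapositive form: a positive quotient norm forces non-compactness.\<close>

lemma qnorm_compact:
  assumes "a \<in> compact_ideal"
  shows "qnorm a = 0"
proof -
  have a: "a \<in> carrier LA" using assms compact_ideal_subset by auto
  have "qnorm a \<le> linf_norm (((-1) \<odot>\<^bsub>LA\<^esub> a) \<oplus>\<^bsub>LA\<^esub> a)"
    by (rule qnorm_le[OF a compact_ideal_smult[OF assms]])
  then show ?thesis using a qnorm_nonneg[OF a] by (simp add: linf_smult_neg_one_add linf_zero)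
qed

section \<open>Paving\<close>

lemma diag_expectation_closed:
  assumes "a \<in> carrier LA"
  shows "diag_expectation a \<in> carrier LA" "linf_norm (diag_expectation a) \<le> linf_norm a"
proof -
  have *: "op_norm (mat_diag n (\<lambda>i. a n $$ (i, i))) \<le> linf_norm a" if n: "n \<ge> 2" for n
  proof -
    have "op_norm (mat_diag n (\<lambda>i. a n $$ (i, i))) \<le> op_norm (a n)"
      using linf_alg_carrierD[OF assms n] by (intro op_norm_mat_diag cmod_entry_le_op_norm) auto
    then show ?thesis using op_norm_le_linf_norm[OF assms n] by linarith
  qed
  then show "diag_expectation a \<in> carrier LA"
    unfolding diag_expectation_def by (intro linf_alg_carrierI) auto
  show "linf_norm (diag_expectation a) \<le> linf_norm a"
    using * by (intro linf_norm_least) (simp add: diag_expectation_def)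
qed

lemma diag_expectation_minus:
  assumes "a \<in> carrier LA" "b \<in> carrier LA"
  shows "diag_expectation (a \<ominus>\<^bsub>LA\<^esub> b) = diag_expectation a \<ominus>\<^bsub>LA\<^esub> diag_expectation b"
  unfolding linf_minus_eq_restrict[OF assms]
    linf_minus_eq_restrict[OF diag_expectation_closed(1)[OF assms(1)] diag_expectation_closed(1)[OF assms(2)]]
  using assms[THEN linf_alg_carrierD(2)] assms[THEN linf_alg_carrierD(3)]
  by (auto simp: diag_expectation_def restrict_def mat_diag_def fun_eq_iff intro!: eq_matI)

text \<open>For fixed \<open>p\<close> this map is linear and bounded in \<open>x\<close>; linearity
  and the bound are all that openness and scaling use.\<close>

definition pave :: "mat_seq \<Rightarrow> mat_seq \<Rightarrow> mat_seq" where
  "pave p x = p \<otimes>\<^bsub>LA\<^esub> (x \<ominus>\<^bsub>LA\<^esub> diag_expectation x) \<otimes>\<^bsub>LA\<^esub> p"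

lemma pave_closed: "p \<in> carrier LA \<Longrightarrow> x \<in> carrier LA \<Longrightarrow> pave p x \<in> carrier LA"
  unfolding pave_def by (intro linf_mult LA.minus_closed diag_expectation_closed)

lemma pave_index:
  assumes "p \<in> carrier LA" "x \<in> carrier LA" "n \<ge> 2"
  shows "pave p x n = p n * (x n - mat_diag n (\<lambda>i. x n $$ (i, i))) * p n"
  using assms linf_minus_index[OF assms(2) diag_expectation_closed(1)[OF assms(2)] assms(3)]
  by (simp add: pave_def linf_alg_simps(1)) (simp add: diag_expectation_def)

lemma pave_minus:
  assumes "p \<in> carrier LA" "x \<in> carrier LA" "y \<in> carrier LA"
  shows "pave p x \<ominus>\<^bsub>LA\<^esub> pave p y = pave p (x \<ominus>\<^bsub>LA\<^esub> y)"
proof (rule linf_alg_eqI)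
  fix n :: nat assume n: "n \<ge> 2"
  note P = linf_alg_carrierD(1)[OF assms(1) n]
  note X = linf_alg_carrierD(1)[OF assms(2) n]
  note Y = linf_alg_carrierD(1)[OF assms(3) n]
  define X' where "X' = x n - mat_diag n (\<lambda>i. x n $$ (i, i))"
  define Y' where "Y' = y n - mat_diag n (\<lambda>i. y n $$ (i, i))"
  have c: "X' \<in> carrier_mat n n" "Y' \<in> carrier_mat n n"
    by (auto simp: X'_def Y'_def intro!: minus_carrier_mat)
  have "(pave p x \<ominus>\<^bsub>LA\<^esub> pave p y) n = p n * X' * p n - p n * Y' * p n"
    using assms n by (simp add: linf_minus_index pave_closed pave_index X'_def Y'_def)
  also have "\<dots> = p n * (X' - Y') * p n"
    using P c by (simp add: mult_minus_distrib_mat[OF P c] minus_mult_distrib_mat[of _ n n _ _ n])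
  \<comment> \<open>Taking the diagonal part is additive, so off-diagonal parts may be subtracted
    before or after they are formed.\<close>
  also have "X' - Y' = (x n - y n) - mat_diag n (\<lambda>i. (x n - y n) $$ (i, i))"
    using X Y by (intro eq_matI) (auto simp: X'_def Y'_def mat_diag_def)
  also have "p n * \<dots> * p n = pave p (x \<ominus>\<^bsub>LA\<^esub> y) n"
    using assms n by (simp add: linf_minus_index pave_index)
  finally show "(pave p x \<ominus>\<^bsub>LA\<^esub> pave p y) n = pave p (x \<ominus>\<^bsub>LA\<^esub> y) n" .
qed (use assms in \<open>auto intro!: LA.minus_closed pave_closed\<close>)

lemma pave_smult:
  assumes "p \<in> carrier LA" "x \<in> carrier LA"
  shows "pave p (c \<odot>\<^bsub>LA\<^esub> x) = c \<odot>\<^bsub>LA\<^esub> pave p x"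
proof (rule linf_alg_eqI)
  fix n :: nat assume n: "n \<ge> 2"
  note P = linf_alg_carrierD(1)[OF assms(1) n]
  note X = linf_alg_carrierD(1)[OF assms(2) n]
  define X' where "X' = x n - mat_diag n (\<lambda>i. x n $$ (i, i))"
  have c: "X' \<in> carrier_mat n n" by (auto simp: X'_def intro!: minus_carrier_mat)
  have "c \<cdot>\<^sub>m x n - mat_diag n (\<lambda>i. (c \<cdot>\<^sub>m x n) $$ (i, i)) = c \<cdot>\<^sub>m X'"
    using X by (intro eq_matI) (auto simp: X'_def mat_diag_def algebra_simps)
  moreover have "pave p (c \<odot>\<^bsub>LA\<^esub> x) n = p n * (c \<cdot>\<^sub>m x n - mat_diag n (\<lambda>i. (c \<cdot>\<^sub>m x n) $$ (i, i))) * p n"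
    using pave_index[OF assms(1) linf_smult_closed[OF assms(2)] n, of c] n by (simp add: linf_alg_simps(5))
  moreover have "(c \<odot>\<^bsub>LA\<^esub> pave p x) n = c \<cdot>\<^sub>m (p n * X' * p n)"
    using n pave_index[OF assms n] by (simp add: X'_def linf_alg_simps(5))
  ultimately show "pave p (c \<odot>\<^bsub>LA\<^esub> x) n = (c \<odot>\<^bsub>LA\<^esub> pave p x) n"
    using P c by (simp add: mult_smult_distrib[OF P c] mult_smult_assoc_mat[of _ n n])
qed (use assms in \<open>auto intro!: pave_closed linf_smult_closed\<close>)

lemma linf_norm_pave_le:
  assumes "p \<in> carrier LA" "x \<in> carrier LA"
  shows "linf_norm (pave p x) \<le> 2 * (linf_norm p)\<^sup>2 * linf_norm x"
proof -
  let ?d = "x \<ominus>\<^bsub>LA\<^esub> diag_expectation x"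
  have d: "?d \<in> carrier LA" using assms by (simp add: diag_expectation_closed)
  have dn: "linf_norm ?d \<le> 2 * linf_norm x"
    using linf_norm_minus_le[OF assms(2) diag_expectation_closed(1)[OF assms(2)]]
      diag_expectation_closed(2)[OF assms(2)] by linarith
  have p0: "linf_norm p \<ge> 0" using linf_norm_nonneg assms by blast
  have "linf_norm (pave p x) \<le> linf_norm (p \<otimes>\<^bsub>LA\<^esub> ?d) * linf_norm p"
    unfolding pave_def using assms d by (intro linf_mult)
  also have "\<dots> \<le> (linf_norm p * linf_norm ?d) * linf_norm p"
    using assms d p0 by (intro mult_right_mono linf_mult)
  also have "\<dots> \<le> (linf_norm p * (2 * linf_norm x)) * linf_norm p"
    using p0 dn by (intro mult_right_mono mult_left_mono)
  finally show ?thesis by (simp add: power2_eq_square mult_ac)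
qed

lemma pave_gap_open:
  assumes p: "p \<in> carrier LA" and x: "x \<in> carrier LA" and gap: "qnorm (pave p x) < qnorm x"
  shows "\<exists>r>0. \<forall>y\<in>carrier LA. linf_dist x y < r \<longrightarrow> qnorm (pave p y) < qnorm y"
proof (intro exI conjI ballI impI)
  \<comment> \<open>The left side can rise by \<open>C - 1\<close> times the distance and the right
    side can fall by once the distance; a gap at \<open>x\<close> larger than \<open>C\<close> times
    the distance therefore survives at \<open>y\<close>.\<close>
  define C where "C = 2 * (linf_norm p)\<^sup>2 + 1"
  have C: "C > 0" by (simp add: C_def add_nonneg_pos)
  define r where "r = (qnorm x - qnorm (pave p x)) / C"
  show "r > 0" using gap C by (simp add: r_def)
  fix y assume y: "y \<in> carrier LA" and "linf_dist x y < r"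
  then have d: "C * linf_norm (x \<ominus>\<^bsub>LA\<^esub> y) < qnorm x - qnorm (pave p x)"
    using x C by (simp add: linf_dist_eq r_def field_simps)
  have "qnorm (pave p y) \<le> qnorm (pave p x) + linf_norm (pave p (x \<ominus>\<^bsub>LA\<^esub> y))"
    using qnorm_le_add[of "pave p y" "pave p x"] linf_norm_minus_commute[of "pave p y" "pave p x"]
      pave_minus[OF p x y] p x y by (simp add: pave_closed)
  also have "linf_norm (pave p (x \<ominus>\<^bsub>LA\<^esub> y)) \<le> (C - 1) * linf_norm (x \<ominus>\<^bsub>LA\<^esub> y)"
    using linf_norm_pave_le[OF p LA.minus_closed[OF x y]] by (simp add: C_def)
  finally have "qnorm (pave p y) + linf_norm (x \<ominus>\<^bsub>LA\<^esub> y) < qnorm x"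
    using d by (simp add: algebra_simps)
  moreover have "qnorm x \<le> qnorm y + linf_norm (x \<ominus>\<^bsub>LA\<^esub> y)"
    by (rule qnorm_le_add[OF x y])
  ultimately show "qnorm (pave p y) < qnorm y" by linarith
qed

text \<open>Rules out the empty partition, whose sum would be zero; the first block, of size 2,
  already separates the two elements.\<close>

lemma one_neq_zero: "\<one>\<^bsub>LA\<^esub> \<noteq> \<zero>\<^bsub>LA\<^esub>"
proof
  assume "\<one>\<^bsub>LA\<^esub> = \<zero>\<^bsub>LA\<^esub>"
  then have "(\<one>\<^bsub>LA\<^esub> 2) $$ (0, 0) = (\<zero>\<^bsub>LA\<^esub> 2) $$ (0, 0)" by simp
  then show False by (simp add: linf_alg_simps)
qed

text \<open>Collects the conditions on the projections that do not mention \<open>x\<close>, so that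
  one partition can be carried over to nearby elements and to multiples.\<close>

definition diag_partition :: "nat \<Rightarrow> (nat \<Rightarrow> mat_seq) \<Rightarrow> bool" where
  "diag_partition m p \<longleftrightarrow>
     (\<forall>j\<in>{1..m}. p j \<in> diag_subalg \<and> linf_projection (p j)) \<and> finsum LA p {1..m} = \<one>\<^bsub>LA\<^esub>"

lemma diag_partitionD:
  assumes "diag_partition m p"
  shows "m \<ge> 1" "\<And>j. j \<in> {1..m} \<Longrightarrow> p j \<in> carrier LA"
proof -
  show "m \<ge> 1"
    using assms one_neq_zero by (cases m) (auto simp: diag_partition_def)
  show "p j \<in> carrier LA" if "j \<in> {1..m}" for j
    using assms that by (simp add: diag_partition_def diag_subalg_def)
qed

text \<open>Non-compactness is implied by the paving inequalities: there is at least one of them,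
  and it makes the quotient norm of \<open>x\<close> positive.\<close>

lemma weakly_paveable_iff:
  "weakly_paveable x \<longleftrightarrow>
     x \<in> linf_pos \<and> (\<exists>m p. diag_partition m p \<and> (\<forall>j\<in>{1..m}. qnorm (pave (p j) x) < qnorm x))"
    (is "_ \<longleftrightarrow> ?R")
proof
  assume "weakly_paveable x"
  then show ?R by (auto simp: weakly_paveable_def diag_partition_def pave_def)
next
  assume R: ?R
  then obtain m p where x: "x \<in> linf_pos" and mp: "diag_partition m p"
    and gap: "\<forall>j\<in>{1..m}. qnorm (pave (p j) x) < qnorm x" by blast
  have "1 \<in> {1..m}" using diag_partitionD(1)[OF mp] by simp
  then have "0 \<le> qnorm (pave (p 1) x)" "qnorm (pave (p 1) x) < qnorm x"
    using gap x linf_pos_subset diag_partitionD(2)[OF mp] by (auto intro!: qnorm_nonneg pave_closed)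
  then have "x \<notin> compact_ideal" using qnorm_compact[of x] by auto
  with R show "weakly_paveable x"
    by (auto simp: weakly_paveable_def diag_partition_def pave_def)
qed

lemma weakly_paveable_smult:
  assumes "weakly_paveable x" "c > 0"
  shows "weakly_paveable (complex_of_real c \<odot>\<^bsub>LA\<^esub> x)"
proof -
  let ?c = "complex_of_real c"
  obtain m p where x: "x \<in> linf_pos" and mp: "diag_partition m p"
    and gap: "\<forall>j\<in>{1..m}. qnorm (pave (p j) x) < qnorm x"
    using assms(1) by (auto simp: weakly_paveable_iff)
  have xc: "x \<in> carrier LA" using x linf_pos_subset by auto
  have "qnorm (pave (p j) (?c \<odot>\<^bsub>LA\<^esub> x)) < qnorm (?c \<odot>\<^bsub>LA\<^esub> x)" if "j \<in> {1..m}" for j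
    using gap that assms(2) xc diag_partitionD(2)[OF mp that]
    by (simp add: pave_smult qnorm_smult pave_closed)
  then show ?thesis
    using mp linf_pos_smult[OF x, of c] assms(2) unfolding weakly_paveable_iff by force
qed

theorem theorem3p1:
  shows "openin linf_pos_topology {x. weakly_paveable x} \<and>
    (\<forall>x (c::real). weakly_paveable x \<longrightarrow> c > 0 \<longrightarrow>
       weakly_paveable (complex_of_real c \<odot>\<^bsub>linf_alg\<^esub> x))"
proof (intro conjI allI impI)
  \<comment> \<open>Neither positivity nor non-compactness appears: the first is restored by
    intersection, the second follows from the inequalities by
    \<open>weakly_paveable_iff\<close>.\<close>
  define T where "T = {x \<in> carrier LA. \<exists>m p. diag_partition m p \<and>
    (\<forall>j\<in>{1..m}. qnorm (pave (p j) x) < qnorm x)}"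
  have "openin LA.mtopology T"
    unfolding LA.openin_mtopology
  proof (intro conjI allI impI)
    fix x assume "x \<in> T"
    then obtain m p where x: "x \<in> carrier LA" and mp: "diag_partition m p"
      and gap: "\<forall>j\<in>{1..m}. qnorm (pave (p j) x) < qnorm x" by (auto simp: T_def)
    have "\<forall>j\<in>{1..m}. \<exists>r>0. \<forall>y\<in>carrier LA. linf_dist x y < r \<longrightarrow> qnorm (pave (p j) y) < qnorm y"
      using pave_gap_open[OF _ x] gap diag_partitionD(2)[OF mp] by blast
    then obtain r where r: "\<And>j. j \<in> {1..m} \<Longrightarrow> r j > (0::real)"
      "\<And>j y. \<lbrakk>j \<in> {1..m}; y \<in> carrier LA; linf_dist x y < r j\<rbrakk> \<Longrightarrow> qnorm (pave (p j) y) < qnorm y"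
      by metis
    have ne: "{1..m} \<noteq> {}" using diag_partitionD(1)[OF mp] by simp
    show "\<exists>e>0. LA.mball x e \<subseteq> T"
    proof (intro exI conjI subsetI)
      \<comment> \<open>A minimum of finitely many positive radii; \<open>m \<ge> 1\<close> makes
        the set nonempty, so \<open>Min\<close> has its expected meaning.\<close>
      show "Min (r ` {1..m}) > 0" using r(1) ne by simp
      fix y assume "y \<in> LA.mball x (Min (r ` {1..m}))"
      then have y: "y \<in> carrier LA" and "linf_dist x y < Min (r ` {1..m})" by auto
      then have "\<forall>j\<in>{1..m}. linf_dist x y < r j" using ne by simp
      then show "y \<in> T" using r(2) y mp unfolding T_def by blast
    qed
  qed (auto simp: T_def)
  moreover have "{x. weakly_paveable x} = T \<inter> linf_pos"
    using linf_pos_subset by (auto simp: T_def weakly_paveable_iff)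
  ultimately show "openin linf_pos_topology {x. weakly_paveable x}"
    unfolding linf_pos_topology_def openin_subtopology by blast
qed (rule weakly_paveable_smult)

end
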